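(* There is an absolute constant $C>0$ such that for every integer $m>0$ and every $x_1,\ldots,x_m\in\ell_\infty$, there are signs $\varepsilon_1,\ldots,\varepsilon_m\in\{-1,1\}$ for which $$\left\|\sum_{i=1}^m\varepsilon_i x_i\right\|_\infty\le C\sqrt{\log d}\cdot\max_{1\le i\le m}\|x_i\|_2\le C\sqrt{\log m}\cdot\max_{1\le i\le m}\|x_i\|_2,$$ where $d$ is the dimension of the linear span of $x_1,\ldots,x_m$.
   Context: For a real sequence $x=(x_j)_{j\ge1}$, $\|x\|_2=(\sum_j|x_j|^2)^{1/2}\in[0,\infty]$ and $\|x\|_\infty=\sup_j|x_j|$; $\ell_\infty$ is the space of real sequences with $\|x\|_\infty<\infty$.
   Formalization: The logarithms log d and log m are read as log max(2,d) and log max(2,m), since the literal bound fails for d = 1 (e.g. m = 1, x_1 = e_1 gives 1 ≤ 0) and log 0 is undefined for d = 0; for d ≥ 2 nothing changes. *)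

theory Defs
  imports "HOL-Analysis.Analysis"
begin

text \<open>Since every function on the discrete space \<^typ>\<open>nat\<close> is continuous, the bounded continuous
  functions on it are exactly the bounded real sequences, \<^const>\<open>norm\<close> on this type is the
  supremum norm, and the operations are coordinatewise. Sequences are indexed from 0.\<close>

type_synonym linf = "nat \<Rightarrow>\<^sub>C real"

text \<open>The \<open>\<ell>\<^sub>2\<close>-norm of an arbitrary real sequence, with value \<open>\<infinity>\<close> when the
  squares are not summable; elements of \<open>\<ell>\<^sub>\<infinity>\<close> may have infinite \<open>\<ell>\<^sub>2\<close>-norm.\<close>

definition l2norm :: "(nat \<Rightarrow> real) \<Rightarrow> ennreal" where
  "l2norm x = (if summable (\<lambda>j. \<bar>x j\<bar>\<^sup>2) then ennreal (sqrt (\<Sum>j. \<bar>x j\<bar>\<^sup>2)) else \<infinity>)"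

text \<open>The natural logarithm, with its argument raised to 2 in the degenerate cases 0 and 1.
  With the literal value \<open>ln 1 = 0\<close> an upper bound proportional to \<open>sqrt (ln d)\<close>
  fails for a single nonzero vector of finite norm. For \<open>n \<ge> 2\<close> this is just \<open>ln n\<close>, and it is
  always positive, so no product \<open>0 * \<infinity>\<close> occurs.\<close>

definition nlog :: "nat \<Rightarrow> real" where
  "nlog n = ln (max 2 (real n))"

end

theory Submission imports Defs begin

text \<open>Normalise the vectors to \<open>\<ell>\<^sub>2\<close>-norm at most 1. The Gram--Schmidt walk of Bansal, Dadush, Garg and
  Lovett moves a fractional point of the cube from \<open>0\<close> to a vertex: it always moves along the component
  of a pivot vector orthogonal to the other alive vectors, forwards or backwards with mean zero, until a
  further coordinate becomes \<open>\<pm>1\<close>. The resulting signed sum \<open>X\<close> is subgaussian: the expectation of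
  \<open>exp \<langle>\<theta>, X\<rangle>\<close> is at most \<open>exp (\<parallel>\<theta>\<parallel>\<^sup>2 / 2)\<close> for every \<open>\<theta>\<close>. Only a fixed finite nonnegative combination of
  such expectations is needed, so the walk is derandomised by always taking the better direction.

  The coordinate functionals, projected to the \<open>d\<close>-dimensional span, have squared norms of at most 1 summing
  to at most \<open>d\<close>. Hence a union bound over all coordinates loses only a factor \<open>d\<close>, however many coordinates
  there are.\<close>

section \<open>Moment generating functions of two-point distributions\<close>

text \<open>If \<open>\<zeta>\<close> is a random sign with mean \<open>z\<close>, then \<open>tilt z t\<close> is the expectation of \<open>exp (t * \<zeta>)\<close>, and
  \<open>ctilt z\<close> is the derivative of \<open>tilt z\<close>.\<close>

definition tilt :: "real \<Rightarrow> real \<Rightarrow> real" where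
  "tilt z t = ((1 + z) * exp t + (1 - z) * exp (- t)) / 2"

definition ctilt :: "real \<Rightarrow> real \<Rightarrow> real" where
  "ctilt z t = ((1 + z) * exp t - (1 - z) * exp (- t)) / 2"

lemma tilt_pos:
  assumes "\<bar>z\<bar> \<le> 1"
  shows "tilt z t > 0"
proof (cases "z = 1")
  case False
  then have "(1 + z) * exp t \<ge> 0" "(1 - z) * exp (- t) > 0"
    using assms by auto
  then show ?thesis by (simp add: tilt_def)
qed (simp add: tilt_def)

lemma tilt_sq_diff: "(tilt z t)\<^sup>2 - (ctilt z t)\<^sup>2 = 1 - z\<^sup>2"
proof -
  have "(tilt z t)\<^sup>2 - (ctilt z t)\<^sup>2 = (1 - z\<^sup>2) * (exp t * exp (- t))"
    by (simp add: tilt_def ctilt_def power2_eq_square algebra_simps add_divide_distrib diff_divide_distrib)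
  then show ?thesis by (simp flip: exp_add)
qed

lemma DERIV_tilt: "(tilt z has_real_derivative ctilt z t) (at t)"
  unfolding tilt_def[abs_def] ctilt_def
  by (auto intro!: derivative_eq_intros simp: field_simps)

lemma DERIV_ctilt: "(ctilt z has_real_derivative tilt z t) (at t)"
  unfolding ctilt_def[abs_def] tilt_def
  by (auto intro!: derivative_eq_intros simp: field_simps)

lemma DERIV_ln_tilt:
  assumes "\<bar>z\<bar> \<le> 1"
  shows "((\<lambda>t. ln (tilt z t)) has_real_derivative ctilt z t / tilt z t) (at t)"
  using tilt_pos[OF assms, of t]
  by (auto intro!: derivative_eq_intros DERIV_tilt)

lemma DERIV_ctilt_div_tilt:
  assumes "\<bar>z\<bar> \<le> 1"
  shows "((\<lambda>t. ctilt z t / tilt z t) has_real_derivative (1 - z\<^sup>2) / (tilt z t)\<^sup>2) (at t)"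
  using tilt_pos[OF assms, of t] tilt_sq_diff[of z t]
  by (auto intro!: derivative_eq_intros DERIV_tilt DERIV_ctilt simp: power2_eq_square)

text \<open>The second derivative is the variance of the exponentially tilted sign.\<close>

lemma convex_ln_tilt:
  assumes "\<bar>z\<bar> \<le> 1"
  shows "convex_on UNIV (\<lambda>t. ln (tilt z t))"
  by (rule f''_ge0_imp_convex[OF _ DERIV_ln_tilt[OF assms] DERIV_ctilt_div_tilt[OF assms]])
     (use assms in \<open>auto simp: abs_square_le_1\<close>)

text \<open>Hoeffding's lemma for a random sign with mean \<open>z\<close>.\<close>

lemma ln_tilt_le:
  assumes "\<bar>z\<bar> \<le> 1"
  shows "ln (tilt z t) \<le> t * z + t\<^sup>2 / 2"
proof -
  \<comment> \<open>\<open>h\<close> and its derivative vanish at 0, so it suffices that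
    \<open>h\<close> is convex and hence lies above its tangent there.\<close>
  define h where "h t = t * z + t\<^sup>2 / 2 - ln (tilt z t)" for t
  have h': "(h has_real_derivative z + t - ctilt z t / tilt z t) (at t)" for t
    unfolding h_def[abs_def]
    by (rule DERIV_ln_tilt[OF assms] derivative_eq_intros refl | simp)+
  have h'': "((\<lambda>t. z + t - ctilt z t / tilt z t) has_real_derivative
      1 - (1 - z\<^sup>2) / (tilt z t)\<^sup>2) (at t)" for t
    by (rule DERIV_ctilt_div_tilt[OF assms] derivative_eq_intros refl | simp)+
  have "(1 - z\<^sup>2) / (tilt z t)\<^sup>2 \<le> 1" for t
  proof -
    have "1 - z\<^sup>2 \<le> (tilt z t)\<^sup>2"
      unfolding tilt_sq_diff[of z t, symmetric] by simp
    then show ?thesis using tilt_pos[OF assms, of t] by (simp add: divide_le_eq)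
  qed
  then have "convex_on UNIV h"
    by (intro f''_ge0_imp_convex[OF _ h' h'']) auto
  then have "h t - h 0 \<ge> (z + 0 - ctilt z 0 / tilt z 0) * (t - 0)"
    by (rule convex_on_imp_above_tangent) (use h'[of 0] in \<open>auto intro: has_field_derivative_at_within\<close>)
  then show ?thesis by (simp add: h_def tilt_def ctilt_def)
qed

text \<open>For \<open>0 \<le> r \<le> 1\<close> the \<open>r\<close>-th power is concave, so it
  lies below its tangent at \<open>y0\<close>.\<close>

lemma exp_mult_ln_le:
  fixes r y y0 :: real
  assumes "0 \<le> r" "r \<le> 1" "0 < y" "0 < y0"
  shows "exp (r * ln y) \<le> exp (r * ln y0) * (1 + r * (y / y0 - 1))"
proof -
  have "exp ((1 - r) *\<^sub>R 0 + r *\<^sub>R ln (y / y0)) \<le> (1 - r) * exp 0 + r * exp (ln (y / y0))"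
    using assms by (intro convex_onD[OF exp_convex]) auto
  then have "exp (r * ln (y / y0)) \<le> 1 + r * (y / y0 - 1)"
    using assms by (simp add: algebra_simps)
  moreover have "exp (r * ln y) = exp (r * ln y0) * exp (r * ln (y / y0))"
    using assms by (simp add: ln_div algebra_simps flip: exp_add)
  ultimately show ?thesis by simp
qed

text \<open>For a random sign \<open>\<zeta>\<close> with mean \<open>z\<close>, \<open>exp (pot z a r)\<close> is the \<open>r\<close>-th power of the expectation of
  \<open>exp (a / r * (\<zeta> - z))\<close>. For \<open>r = 0\<close> the division by zero is harmless, since then \<open>a = 0\<close> below.\<close>

definition pot :: "real \<Rightarrow> real \<Rightarrow> real \<Rightarrow> real" where
  "pot z a r = r * ln (tilt z (a / r)) - a * z"

lemma pot_le:
  assumes "\<bar>z\<bar> \<le> 1" "r \<ge> 0" "r = 0 \<Longrightarrow> a = 0"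
  shows "pot z a r \<le> a\<^sup>2 / r / 2"
proof (cases "r = 0")
  case False
  have "r * ln (tilt z (a / r)) \<le> r * ((a / r) * z + (a / r)\<^sup>2 / 2)"
    by (intro mult_left_mono ln_tilt_le assms)
  also have "\<dots> = a * z + a\<^sup>2 / r / 2"
    using False by (simp add: field_simps power2_eq_square)
  finally show ?thesis by (simp add: pot_def)
qed (use assms in \<open>simp add: pot_def\<close>)

text \<open>A sign of mean \<open>1\<close> or \<open>-1\<close> is deterministic, so its centred
  exponential moment is 1.\<close>

lemma pot_frozen:
  assumes "\<bar>z\<bar> = 1" "r = 0 \<Longrightarrow> a = 0"
  shows "pot z a r = 0"
proof -
  from assms(1) have "z = 1 \<or> z = -1" by linarith
  then show ?thesis using assms(2) by (cases "r = 0") (auto simp: pot_def tilt_def)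
qed

text \<open>The perspective \<open>r * f (a / r)\<close> of the convex function
  \<open>f = ln (tilt z)\<close> is subadditive in \<open>(a, r)\<close>; \<open>pot_le\<close> then
  bounds the second summand.\<close>

lemma pot_add_le:
  assumes "\<bar>z\<bar> \<le> 1" "r \<ge> 0" "s \<ge> 0" "r = 0 \<Longrightarrow> a = 0" "s = 0 \<Longrightarrow> e = 0"
  shows "pot z (a + e) (r + s) \<le> pot z a r + e\<^sup>2 / s / 2"
proof -
  have "pot z (a + e) (r + s) \<le> pot z a r + pot z e s"
  proof (cases "r + s = 0")
    case True
    then have "r = 0" "s = 0" using assms by linarith+
    then show ?thesis using assms by (simp add: pot_def)
  next
    case False
    then have rs: "r + s > 0" using assms by linarith
    have w: "1 - s / (r + s) = r / (r + s)" using rs by (simp add: field_simps)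
    have *: "(1 - s / (r + s)) * (a / r) + s / (r + s) * (e / s) = (a + e) / (r + s)"
      using assms(4,5) unfolding w
      by (cases "r = 0"; cases "s = 0") (auto simp: add_divide_distrib)
    have "ln (tilt z ((1 - s / (r + s)) *\<^sub>R (a / r) + (s / (r + s)) *\<^sub>R (e / s)))
        \<le> (1 - s / (r + s)) * ln (tilt z (a / r)) + s / (r + s) * ln (tilt z (e / s))"
      using rs assms by (intro convex_onD[OF convex_ln_tilt]) auto
    then have "(r + s) * ln (tilt z ((a + e) / (r + s)))
        \<le> (r + s) * ((1 - s / (r + s)) * ln (tilt z (a / r)) + s / (r + s) * ln (tilt z (e / s)))"
      using rs * by (intro mult_left_mono) auto
    also have "\<dots> = r * ln (tilt z (a / r)) + s * ln (tilt z (e / s))"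
      unfolding w using rs by (simp add: distrib_left)
    finally show ?thesis by (simp add: pot_def algebra_simps)
  qed
  then show ?thesis using pot_le[OF assms(1,3,5)] by simp
qed

text \<open>A mean-zero step of \<open>z\<close> to \<open>z + dp\<close> or \<open>z - dm\<close> does not increase the expected potential: up to the
  factor \<open>exp (- a * z)\<close>, the potential is the \<open>r\<close>-th power of an affine function of \<open>z\<close>.\<close>

lemma pot_step:
  assumes d: "dp > 0" "dm > 0" and z: "\<bar>z + dp\<bar> \<le> 1" "\<bar>z - dm\<bar> \<le> 1"
    and r: "0 \<le> r" "r \<le> 1" "r = 0 \<Longrightarrow> a = 0"
  shows "dm * exp (a * dp + pot (z + dp) a r) + dp * exp (- a * dm + pot (z - dm) a r)
    \<le> (dp + dm) * exp (pot z a r)"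
proof -
  define y where "y w = tilt w (a / r)" for w
  have z0: "\<bar>z\<bar> \<le> 1" using d z by linarith
  have ypos: "y (z + dp) > 0" "y (z - dm) > 0" "y z > 0"
    using z z0 by (auto simp: y_def intro: tilt_pos)
  \<comment> \<open>\<open>tilt\<close> is affine in the mean, and the weights \<open>dm\<close> and
    \<open>dp\<close> make the two end points average to \<open>z\<close>.\<close>
  have lin: "dm * y (z + dp) + dp * y (z - dm) = (dp + dm) * y z"
    by (simp add: y_def tilt_def field_simps)
  have e: "exp (a * (w - z) + pot w a r) = exp (- a * z) * exp (r * ln (y w))" for w
    by (simp add: pot_def y_def algebra_simps flip: exp_add)
  have "dm * exp (r * ln (y (z + dp))) + dp * exp (r * ln (y (z - dm)))
      \<le> dm * (exp (r * ln (y z)) * (1 + r * (y (z + dp) / y z - 1)))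
       + dp * (exp (r * ln (y z)) * (1 + r * (y (z - dm) / y z - 1)))"
    using d r ypos by (intro add_mono mult_left_mono exp_mult_ln_le) auto
  also have "\<dots> = exp (r * ln (y z)) *
      ((dp + dm) * (1 - r) + r * ((dm * y (z + dp) + dp * y (z - dm)) / y z))"
    by (simp add: algebra_simps add_divide_distrib)
  also have "(dm * y (z + dp) + dp * y (z - dm)) / y z = dp + dm"
    using ypos(3) by (simp add: lin)
  also have "exp (r * ln (y z)) * ((dp + dm) * (1 - r) + r * (dp + dm)) = (dp + dm) * exp (r * ln (y z))"
    by (simp add: algebra_simps)
  finally have "exp (- a * z) * (dm * exp (r * ln (y (z + dp))) + dp * exp (r * ln (y (z - dm))))
      \<le> exp (- a * z) * ((dp + dm) * exp (r * ln (y z)))"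
    by (intro mult_left_mono) auto
  then show ?thesis
    using e[of "z + dp"] e[of "z - dm"] e[of z] by (simp add: algebra_simps)
qed

section \<open>Moving to the boundary of the cube\<close>

lemma step_to_boundary:
  fixes z u :: "'i \<Rightarrow> real"
  assumes "finite A" "p \<in> A" "u p \<noteq> 0" and z: "\<And>i. i \<in> A \<Longrightarrow> \<bar>z i\<bar> < 1"
  obtains d where "d > 0" "\<And>i. i \<in> A \<Longrightarrow> \<bar>z i + d * u i\<bar> \<le> 1" "\<exists>i\<in>A. \<bar>z i + d * u i\<bar> = 1"
proof -
  define B where "B = {i\<in>A. u i \<noteq> 0}"
  \<comment> \<open>The time at which a moving coordinate meets the face ahead of it; the first such
    time is \<open>d\<close>.\<close>
  define t where "t i = (1 - sgn (u i) * z i) / \<bar>u i\<bar>" for i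
  have B: "finite B" "B \<noteq> {}" using assms by (auto simp: B_def)
  have sz: "\<bar>sgn (u i) * z i\<bar> < 1" if "i \<in> B" for i
    using that z by (auto simp: B_def abs_mult abs_sgn_eq)
  have uz: "\<bar>z i + d * u i\<bar> = \<bar>sgn (u i) * z i + d * \<bar>u i\<bar>\<bar>" if "i \<in> B" for i d
    using that by (auto simp: B_def sgn_if abs_if)
  have tpos: "t i > 0" if "i \<in> B" for i
    using sz[OF that] that by (auto simp: t_def B_def)
  define d where "d = Min (t ` B)"
  have dpos: "d > 0" using B tpos by (auto simp: d_def)
  have dle: "d \<le> t i" if "i \<in> B" for i using B that by (auto simp: d_def)
  have "d \<in> t ` B" unfolding d_def using B by (intro Min_in) auto
  then obtain k where k: "k \<in> B" "d = t k" by auto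
  have "d * \<bar>u k\<bar> = 1 - sgn (u k) * z k" using k by (auto simp: t_def B_def)
  then have "\<bar>z k + d * u k\<bar> = 1" using uz[OF k(1)] by simp
  moreover have "\<bar>z i + d * u i\<bar> \<le> 1" if "i \<in> A" for i
  proof (cases "i \<in> B")
    case True
    have "d * \<bar>u i\<bar> \<le> 1 - sgn (u i) * z i"
      using dle[OF True] True by (auto simp: t_def B_def le_divide_eq)
    moreover have "d * \<bar>u i\<bar> \<ge> 0" using dpos by simp
    ultimately show ?thesis using sz[OF True] unfolding uz[OF True] by linarith
  next
    case False
    then show ?thesis using that z[OF that] by (simp add: B_def)
  qed
  ultimately show ?thesis using that dpos k(1) unfolding B_def by blast
qed

section \<open>The Gram--Schmidt walk\<close>

text \<open>Semidefiniteness is what holds in the application, where the form sees only finitely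
  many coordinates.\<close>

locale semi_inner =
  fixes ip :: "'a::real_vector \<Rightarrow> 'a \<Rightarrow> real"
  assumes ip_commute: "ip x y = ip y x"
    and ip_add_left: "ip (x + y) w = ip x w + ip y w"
    and ip_scaleR_left: "ip (r *\<^sub>R x) y = r * ip x y"
    and ip_nonneg: "ip x x \<ge> 0"
begin

lemma ip_add_right: "ip w (x + y) = ip w x + ip w y"
  by (metis ip_add_left ip_commute)

lemma ip_scaleR_right: "ip y (r *\<^sub>R x) = r * ip y x"
  by (metis ip_scaleR_left ip_commute)

lemma ip_diff_left: "ip (x - y) w = ip x w - ip y w"
  using ip_add_left[of "x - y" y w] by simp

lemma ip_diff_right: "ip w (x - y) = ip w x - ip w y"
  by (metis ip_diff_left ip_commute)

lemma ip_zero_left [simp]: "ip 0 x = 0"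
  using ip_scaleR_left[of 0 0 x] by simp

lemma ip_zero_right [simp]: "ip x 0 = 0"
  by (metis ip_zero_left ip_commute)

lemma ip_sum_left: "ip (\<Sum>i\<in>A. f i) y = (\<Sum>i\<in>A. ip (f i) y)"
  by (induction A rule: infinite_finite_induct) (auto simp: ip_add_left)

lemma ip_sum_right: "ip y (\<Sum>i\<in>A. f i) = (\<Sum>i\<in>A. ip y (f i))"
  by (induction A rule: infinite_finite_induct) (auto simp: ip_add_right)

lemmas ip_simps = ip_add_left ip_add_right ip_diff_left ip_diff_right
  ip_scaleR_left ip_scaleR_right ip_sum_left ip_sum_right

text \<open>Otherwise the squared length of \<open>y + t *\<^sub>R x\<close> would be a nonconstant
  affine function of \<open>t\<close>, hence negative somewhere. This makes division by a zero
  squared length harmless in projections.\<close>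

lemma ip_null:
  assumes "ip x x = 0"
  shows "ip y x = 0"
proof (rule ccontr)
  assume n: "ip y x \<noteq> 0"
  define t where "t = - (ip y y + 1) / (2 * ip y x)"
  have "0 \<le> ip (y + t *\<^sub>R x) (y + t *\<^sub>R x)" by (rule ip_nonneg)
  also have "\<dots> = ip y y + 2 * t * ip y x"
    using assms by (simp add: ip_simps ip_commute[of x y])
  also have "\<dots> = -1" using n by (simp add: t_def field_simps)
  finally show False by simp
qed

text \<open>Gram--Schmidt: the residual of \<open>x\<close> is corrected by its projection onto the
  residual \<open>r\<close> of the added vector \<open>v q\<close>.\<close>

lemma residual_exists:
  assumes "finite A"
  shows "\<exists>u. \<forall>k\<in>A. ip (x + (\<Sum>i\<in>A. u i *\<^sub>R v i)) (v k) = 0"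
  using assms
proof (induction A arbitrary: x rule: finite_induct)
  case (insert q A)
  obtain c where c: "\<forall>k\<in>A. ip (x + (\<Sum>i\<in>A. c i *\<^sub>R v i)) (v k) = 0"
    using insert.IH by blast
  obtain d where d: "\<forall>k\<in>A. ip (v q + (\<Sum>i\<in>A. d i *\<^sub>R v i)) (v k) = 0"
    using insert.IH by blast
  define s where "s = x + (\<Sum>i\<in>A. c i *\<^sub>R v i)"
  define r where "r = v q + (\<Sum>i\<in>A. d i *\<^sub>R v i)"
  define t where "t = ip s r / ip r r"
  define u where "u i = (if i = q then - t else c i - t * d i)" for i
  have "(\<Sum>i\<in>A. u i *\<^sub>R v i) = (\<Sum>i\<in>A. c i *\<^sub>R v i - t *\<^sub>R d i *\<^sub>R v i)"
    using insert.hyps by (intro sum.cong) (auto simp: u_def scaleR_diff_left)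
  then have res: "x + (\<Sum>i\<in>insert q A. u i *\<^sub>R v i) = s - t *\<^sub>R r"
    using insert.hyps
    by (simp add: s_def r_def sum_subtractf scaleR_sum_right algebra_simps) (simp add: u_def)
  have orth: "ip (s - t *\<^sub>R r) (v k) = 0" if "k \<in> A" for k
    using c d that by (simp add: s_def r_def ip_diff_left ip_scaleR_left)
  have "ip (s - t *\<^sub>R r) r = 0"
    using ip_null[of r s] by (cases "ip r r = 0") (auto simp: t_def ip_diff_left ip_scaleR_left)
  then have "ip (s - t *\<^sub>R r) (v q) = 0"
    using orth by (simp add: r_def ip_add_right ip_sum_right ip_scaleR_right)
  then show ?case using orth res by (intro exI[of _ u]) auto
qed simp

lemma ip_orth_sum:
  assumes "\<And>i. i \<in> A \<Longrightarrow> ip b (v i) = 0" "B \<subseteq> A"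
  shows "ip b (\<Sum>i\<in>B. u i *\<^sub>R v i) = 0"
  using assms by (simp add: ip_sum_right ip_scaleR_right subset_iff)

text \<open>The state of the walk: a fractional point \<open>z\<close>, the pivot \<open>p\<close>, the other alive indices \<open>A\<close>, and the
  component \<open>b\<close> of \<open>v p\<close> orthogonal to the vectors of \<open>A\<close>. The functional \<open>\<theta> j\<close> may be replaced by any \<open>\<eta> j\<close>
  agreeing with it on these vectors. When \<open>A\<close> shrinks to \<open>A'\<close>, \<open>b\<close> changes by an orthogonal vector \<open>w\<close>, and
  removing the component along \<open>w\<close> from \<open>\<eta> j\<close> pays for the increase of the potential.\<close>

lemma gram_schmidt_walk_phase:
  fixes v :: "'i \<Rightarrow> 'a" and \<theta> \<eta> :: "'j \<Rightarrow> 'a"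
  assumes "finite A" "p \<notin> A" "\<And>i. i \<in> A \<Longrightarrow> \<bar>z i\<bar> < 1" "\<bar>z p\<bar> \<le> 1"
    and "\<And>i. i \<in> insert p A \<Longrightarrow> ip (v i) (v i) \<le> 1"
    and "b = v p + (\<Sum>i\<in>A. u i *\<^sub>R v i)" "\<And>i. i \<in> A \<Longrightarrow> ip b (v i) = 0"
    and "\<And>j. j \<in> J \<Longrightarrow> c j \<ge> 0"
    and "\<And>i j. i \<in> A \<Longrightarrow> j \<in> J \<Longrightarrow> ip (\<theta> j) (v i) = ip (\<eta> j) (v i)"
  shows "\<exists>\<epsilon>. (\<forall>i\<in>insert p A. \<epsilon> i \<in> {-1, 1}) \<and>
    (\<Sum>j\<in>J. c j * exp (ip (\<theta> j) (\<Sum>i\<in>insert p A. (\<epsilon> i - z i) *\<^sub>R v i)))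
    \<le> (\<Sum>j\<in>J. c j * exp (ip (\<eta> j) (\<eta> j) / 2 + pot (z p) (ip (\<theta> j) b) (ip b b)))"
  using assms
\<comment> \<open>The factor 2 lets an unfrozen pivot taken from \<open>A\<close> replace a frozen
  one while the measure drops; any other step freezes the pivot or shrinks \<open>A\<close>.\<close>
proof (induction "2 * card A + (if \<bar>z p\<bar> = 1 then 0 else 1)" arbitrary: A p z u b \<eta> c rule: less_induct)
  case less
  note fin = less.prems(1) and pA = less.prems(2) and zA = less.prems(3) and zp = less.prems(4)
    and v1 = less.prems(5) and b = less.prems(6) and bA = less.prems(7)
    and c0 = less.prems(8) and \<theta>\<eta> = less.prems(9)
  have null: "ip x b = 0" if "ip b b = 0" for x b using ip_null that by blast
  show ?case
  proof (cases "\<bar>z p\<bar> = 1")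
    case True
    then have zp1: "z p \<in> {-1, 1}" by auto
    have pot0: "pot (z p) (ip (\<theta> j) b) (ip b b) = 0" for j
      using True null by (rule pot_frozen)
    show ?thesis
    proof (cases "A = {}")
      case True
      have "(\<Sum>j\<in>J. c j) \<le> (\<Sum>j\<in>J. c j * exp (ip (\<eta> j) (\<eta> j) / 2))"
        using c0 ip_nonneg mult_left_mono[of 1 "exp _" "c _"] by (intro sum_mono) fastforce
      then show ?thesis using True zp1 by (intro exI[of _ z]) (simp add: pot0)
    next
      case False
      then obtain q where q: "q \<in> A" by auto
      define A' where "A' = A - {q}"
      obtain u' where u': "\<forall>k\<in>A'. ip (v q + (\<Sum>i\<in>A'. u' i *\<^sub>R v i)) (v k) = 0"
        using residual_exists[of A' "v q" v] fin by (auto simp: A'_def)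
      define b' where "b' = v q + (\<Sum>i\<in>A'. u' i *\<^sub>R v i)"
      define t where "t j = ip (\<eta> j) b' / ip b' b'" for j
      \<comment> \<open>\<open>b'\<close> is orthogonal to the vectors of \<open>A'\<close>, so
        agreement with \<open>\<theta> j\<close> persists there; the squared length removed pays for
        the potential of the new pivot.\<close>
      define \<eta>' where "\<eta>' j = \<eta> j - t j *\<^sub>R b'" for j
      have A: "A = insert q A'" "q \<notin> A'" "finite A'" using q fin by (auto simp: A'_def)
      have \<theta>b': "ip (\<theta> j) b' = ip (\<eta> j) b'" if "j \<in> J" for j
        using \<theta>\<eta> that A by (simp add: b'_def ip_add_right ip_sum_right ip_scaleR_right)
      have card: "2 * card A' + (if \<bar>z q\<bar> = 1 then 0 else 1)
          < 2 * card A + (if \<bar>z p\<bar> = 1 then 0 else 1)"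
        using A by simp
      have "\<exists>\<epsilon>. (\<forall>i\<in>insert q A'. \<epsilon> i \<in> {-1, 1}) \<and>
        (\<Sum>j\<in>J. c j * exp (ip (\<theta> j) (\<Sum>i\<in>insert q A'. (\<epsilon> i - z i) *\<^sub>R v i)))
        \<le> (\<Sum>j\<in>J. c j * exp (ip (\<eta>' j) (\<eta>' j) / 2 + pot (z q) (ip (\<theta> j) b') (ip b' b')))"
      proof (rule less.hyps[where A = A' and p = q and z = z and b = b' and u = u' and \<eta> = \<eta>' and c = c])
        show "ip b' (v i) = 0" if "i \<in> A'" for i using u' that by (simp add: b'_def)
        show "ip (\<theta> j) (v i) = ip (\<eta>' j) (v i)" if "i \<in> A'" "j \<in> J" for i j
          using u' that \<theta>\<eta> A by (simp add: \<eta>'_def ip_diff_left ip_scaleR_left b'_def)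
        show "\<bar>z q\<bar> \<le> 1" using zA[OF q] by simp
      qed (use card A zA v1 b'_def c0 in auto)
      then obtain \<epsilon> where \<epsilon>: "\<forall>i\<in>insert q A'. \<epsilon> i \<in> {-1, 1}"
        "(\<Sum>j\<in>J. c j * exp (ip (\<theta> j) (\<Sum>i\<in>insert q A'. (\<epsilon> i - z i) *\<^sub>R v i)))
        \<le> (\<Sum>j\<in>J. c j * exp (ip (\<eta>' j) (\<eta>' j) / 2 + pot (z q) (ip (\<theta> j) b') (ip b' b')))"
        by blast
      have le: "ip (\<eta>' j) (\<eta>' j) / 2 + pot (z q) (ip (\<theta> j) b') (ip b' b') \<le> ip (\<eta> j) (\<eta> j) / 2"
        if j: "j \<in> J" for j
      proof -
        define y where "y = (ip (\<theta> j) b')\<^sup>2 / ip b' b'"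
        have "pot (z q) (ip (\<theta> j) b') (ip b' b') \<le> y / 2"
          unfolding y_def using zA[OF q] ip_nonneg null by (intro pot_le) auto
        moreover have "ip (\<eta>' j) (\<eta>' j) = ip (\<eta> j) (\<eta> j) - y"
          using null[of b']
          by (cases "ip b' b' = 0")
            (auto simp: y_def \<eta>'_def ip_diff_left ip_diff_right ip_scaleR_left ip_scaleR_right t_def
              \<theta>b'[OF j] ip_commute[of b' "\<eta> j"] power2_eq_square)
        ultimately show ?thesis by linarith
      qed
      define \<epsilon>' where "\<epsilon>' = \<epsilon>(p := z p)"
      have "(\<Sum>i\<in>insert p A. (\<epsilon>' i - z i) *\<^sub>R v i) = (\<Sum>i\<in>A. (\<epsilon>' i - z i) *\<^sub>R v i)"
        using fin pA by (simp add: \<epsilon>'_def)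
      also have "\<dots> = (\<Sum>i\<in>A. (\<epsilon> i - z i) *\<^sub>R v i)"
        using pA by (intro sum.cong) (auto simp: \<epsilon>'_def)
      finally have "(\<Sum>j\<in>J. c j * exp (ip (\<theta> j) (\<Sum>i\<in>insert p A. (\<epsilon>' i - z i) *\<^sub>R v i)))
        \<le> (\<Sum>j\<in>J. c j * exp (ip (\<eta>' j) (\<eta>' j) / 2 + pot (z q) (ip (\<theta> j) b') (ip b' b')))"
        using \<epsilon>(2) by (simp flip: A(1))
      also have "\<dots> \<le> (\<Sum>j\<in>J. c j * exp (ip (\<eta> j) (\<eta> j) / 2))"
        using le c0 by (intro sum_mono mult_left_mono) auto
      finally show ?thesis
        using \<epsilon>(1) zp1 A(1) by (intro exI[of _ \<epsilon>']) (auto simp: pot0 \<epsilon>'_def)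
    qed
  next
    case False
    \<comment> \<open>The coefficients of \<open>b\<close>: moving \<open>z\<close> by
      \<open>d\<close> times \<open>U\<close> moves the fractional sum by \<open>d\<close> times
      \<open>b\<close>.\<close>
    define U where "U = u(p := 1)"
    define a where "a j = ip (\<theta> j) b" for j
    define r where "r = ip b b"
    \<comment> \<open>The potential after a step of length \<open>d\<close>, still with the old
      alive set; \<open>exp (a j * d)\<close> records the displacement.\<close>
    define F where "F d = (\<Sum>j\<in>J. c j * exp (a j * d) *
      exp (ip (\<eta> j) (\<eta> j) / 2 + pot (z p + d) (a j) r))" for d
    have "(\<Sum>i\<in>A. U i *\<^sub>R v i) = (\<Sum>i\<in>A. u i *\<^sub>R v i)"
      using pA by (intro sum.cong) (auto simp: U_def)
    then have bU: "b = (\<Sum>i\<in>insert p A. U i *\<^sub>R v i)"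
      using fin pA by (simp add: b) (simp add: U_def)
    have zI: "\<bar>z i\<bar> < 1" if "i \<in> insert p A" for i using that zA zp False by auto
    have r0: "r \<ge> 0" by (simp add: r_def ip_nonneg)
    \<comment> \<open>Pythagoras for \<open>v p = b - g\<close>; this bound supplies the concavity
      in \<open>pot_step\<close>.\<close>
    have r1: "r \<le> 1"
    proof -
      define g where "g = (\<Sum>i\<in>A. u i *\<^sub>R v i)"
      have "ip b g = 0" unfolding g_def using bA by (intro ip_orth_sum[of A]) auto
      moreover have "v p = b - g" by (simp add: b g_def)
      ultimately have "ip (v p) (v p) = r + ip g g"
        by (simp add: r_def ip_diff_left ip_diff_right ip_commute[of g b])
      then show ?thesis using v1[of p] ip_nonneg[of g] by simp
    qed
    have a0: "a j = 0" if "r = 0" for j using null that by (simp add: a_def r_def)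
    obtain dp where dp: "dp > 0" "\<And>i. i \<in> insert p A \<Longrightarrow> \<bar>z i + dp * U i\<bar> \<le> 1"
      "\<exists>i\<in>insert p A. \<bar>z i + dp * U i\<bar> = 1"
      using step_to_boundary[of "insert p A" p U z] fin zI by (auto simp: U_def)
    obtain dm where dm: "dm > 0" "\<And>i. i \<in> insert p A \<Longrightarrow> \<bar>z i + dm * (- U i)\<bar> \<le> 1"
      "\<exists>i\<in>insert p A. \<bar>z i + dm * (- U i)\<bar> = 1"
      using step_to_boundary[of "insert p A" p "\<lambda>i. - U i" z] fin zI by (auto simp: U_def)
    have F: "F d = (\<Sum>j\<in>J. c j * exp (ip (\<eta> j) (\<eta> j) / 2) *
      exp (a j * d + pot (z p + d) (a j) r))" for d
      by (simp add: F_def exp_add mult_ac)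
    have "dm * F dp + dp * F (- dm) = (\<Sum>j\<in>J. c j * exp (ip (\<eta> j) (\<eta> j) / 2) *
      (dm * exp (a j * dp + pot (z p + dp) (a j) r) + dp * exp (- a j * dm + pot (z p - dm) (a j) r)))"
      unfolding F sum_distrib_left sum.distrib[symmetric]
      by (intro sum.cong) (simp_all add: algebra_simps)
    also have "\<dots> \<le> (\<Sum>j\<in>J. c j * exp (ip (\<eta> j) (\<eta> j) / 2) * ((dp + dm) * exp (pot (z p) (a j) r)))"
      using dp(1) dm(1) dp(2)[of p] dm(2)[of p] r0 r1 a0 c0
      by (intro sum_mono mult_left_mono pot_step) (auto simp: U_def)
    also have "\<dots> = (dp + dm) * F 0"
      by (simp add: F sum_distrib_left mult_ac)
    finally have mean: "dm * F dp + dp * F (- dm) \<le> (dp + dm) * F 0" .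
    \<comment> \<open>Derandomisation: a weighted average of the two values is at most
      \<open>F 0\<close>, so one of them is.\<close>
    have "F dp \<le> F 0 \<or> F (- dm) \<le> F 0"
    proof (rule ccontr)
      assume "\<not> ?thesis"
      then have "dm * F 0 < dm * F dp" "dp * F 0 < dp * F (- dm)" using dp(1) dm(1) by auto
      then show False using mean by (simp add: algebra_simps)
    qed
    then obtain d where d: "F d \<le> F 0" "\<And>i. i \<in> insert p A \<Longrightarrow> \<bar>z i + d * U i\<bar> \<le> 1"
      "\<exists>i\<in>insert p A. \<bar>z i + d * U i\<bar> = 1"
      using dp dm by (metis minus_mult_commute)
    define z' where "z' i = z i + d * U i" for i
    define A' where "A' = {i\<in>A. \<bar>z' i\<bar> < 1}"
    \<comment> \<open>The displacement already made is absorbed into the weights.\<close>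
    define c' where "c' j = c j * exp (a j * d)" for j
    have A'A: "A' \<subseteq> A" by (auto simp: A'_def)
    have z'p: "z' p = z p + d" by (simp add: z'_def U_def)
    have z'1: "\<bar>z' i\<bar> \<le> 1" if "i \<in> insert p A" for i using d(2) that by (simp add: z'_def)
    have z'A: "z' i \<in> {-1, 1}" if "i \<in> A - A'" for i
      using that z'1[of i] by (auto simp: A'_def)
    obtain u' where u': "\<forall>k\<in>A'. ip (v p + (\<Sum>i\<in>A'. u' i *\<^sub>R v i)) (v k) = 0"
      using residual_exists[of A' "v p" v] fin finite_subset[OF A'A] by auto
    define b' where "b' = v p + (\<Sum>i\<in>A'. u' i *\<^sub>R v i)"
    have b'A: "ip b' (v i) = 0" if "i \<in> A'" for i using u' that by (simp add: b'_def)
    \<comment> \<open>The pivot cancels, so \<open>w\<close> is a combination of the old alive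
      vectors and orthogonal to \<open>b\<close>; it is also orthogonal to the vectors still
      alive.\<close>
    define w where "w = b' - b"
    define s where "s = ip w w"
    define t where "t j = ip (\<eta> j) w / s" for j
    define \<eta>' where "\<eta>' j = \<eta> j - t j *\<^sub>R w" for j
    have weq: "w = (\<Sum>i\<in>A'. u' i *\<^sub>R v i) - (\<Sum>i\<in>A. u i *\<^sub>R v i)"
      by (simp add: w_def b'_def b)
    have bw: "ip b w = 0"
      unfolding weq ip_diff_right using ip_orth_sum[of A b v] bA A'A by simp
    have wA: "ip w (v i) = 0" if "i \<in> A'" for i
      using b'A bA A'A that by (auto simp: w_def ip_diff_left)
    have \<theta>w: "ip (\<theta> j) w = ip (\<eta> j) w" if "j \<in> J" for j
      using \<theta>\<eta> that A'A by (simp add: weq ip_diff_right ip_sum_right ip_scaleR_right subset_iff)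
    have b'b': "ip b' b' = r + s"
      using bw by (simp add: w_def r_def s_def ip_diff_left ip_diff_right ip_commute[of b' b])
    have \<theta>b': "ip (\<theta> j) b' = a j + ip (\<theta> j) w" for j by (simp add: a_def w_def ip_diff_right)
    have s0: "s \<ge> 0" by (simp add: s_def ip_nonneg)
    have w0: "ip x w = 0" if "s = 0" for x using null that by (simp add: s_def)
    have card: "2 * card A' + (if \<bar>z' p\<bar> = 1 then 0 else 1)
        < 2 * card A + (if \<bar>z p\<bar> = 1 then 0 else 1)"
    proof (cases "\<bar>z' p\<bar> = 1")
      case True
      then show ?thesis using False card_mono[OF fin A'A] by simp
    next
      case 2: False
      then obtain i where "i \<in> A" "\<bar>z' i\<bar> = 1" using d(3) by (auto simp: z'_def)
      then have "i \<in> A" "i \<notin> A'" by (auto simp: A'_def)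
      then have "A' \<subset> A" using A'A by blast
      then have "card A' < card A" by (rule psubset_card_mono[OF fin])
      then show ?thesis using False by simp
    qed
    have "\<exists>\<epsilon>. (\<forall>i\<in>insert p A'. \<epsilon> i \<in> {-1, 1}) \<and>
      (\<Sum>j\<in>J. c' j * exp (ip (\<theta> j) (\<Sum>i\<in>insert p A'. (\<epsilon> i - z' i) *\<^sub>R v i)))
      \<le> (\<Sum>j\<in>J. c' j * exp (ip (\<eta>' j) (\<eta>' j) / 2 + pot (z' p) (ip (\<theta> j) b') (ip b' b')))"
    proof (rule less.hyps[where A = A' and p = p and z = z' and b = b' and u = u' and \<eta> = \<eta>' and c = c'])
      show "ip (\<theta> j) (v i) = ip (\<eta>' j) (v i)" if "i \<in> A'" "j \<in> J" for i j
        using wA that \<theta>\<eta> A'A by (auto simp: \<eta>'_def ip_diff_left ip_scaleR_left)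
      show "finite A'" using fin A'A by (rule rev_finite_subset)
      show "c' j \<ge> 0" if "j \<in> J" for j using c0 that by (simp add: c'_def)
    qed (use card b'_def b'A A'A pA v1 z'1 in \<open>auto simp: A'_def\<close>)
    then obtain \<epsilon> where \<epsilon>: "\<forall>i\<in>insert p A'. \<epsilon> i \<in> {-1, 1}"
      "(\<Sum>j\<in>J. c' j * exp (ip (\<theta> j) (\<Sum>i\<in>insert p A'. (\<epsilon> i - z' i) *\<^sub>R v i)))
      \<le> (\<Sum>j\<in>J. c' j * exp (ip (\<eta>' j) (\<eta>' j) / 2 + pot (z' p) (ip (\<theta> j) b') (ip b' b')))"
      by blast
    have le: "ip (\<eta>' j) (\<eta>' j) / 2 + pot (z' p) (ip (\<theta> j) b') (ip b' b')
        \<le> ip (\<eta> j) (\<eta> j) / 2 + pot (z p + d) (a j) r" if j: "j \<in> J" for j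
    proof -
      \<comment> \<open>The potential grows by at most \<open>y / 2\<close>, exactly half the
        squared length that \<open>\<eta> j\<close> loses.\<close>
      define y where "y = (ip (\<theta> j) w)\<^sup>2 / s"
      have "pot (z' p) (a j + ip (\<theta> j) w) (r + s) \<le> pot (z' p) (a j) r + y / 2"
        unfolding y_def using z'1[of p] r0 s0 a0 w0 by (intro pot_add_le) auto
      moreover have "ip (\<eta>' j) (\<eta>' j) = ip (\<eta> j) (\<eta> j) - y"
        using w0
        by (cases "s = 0")
          (auto simp: y_def \<eta>'_def ip_diff_left ip_diff_right ip_scaleR_left ip_scaleR_right t_def
            \<theta>w[OF j] ip_commute[of w "\<eta> j"] power2_eq_square simp flip: s_def)
      ultimately show ?thesis unfolding \<theta>b' b'b' z'p by linarith
    qed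
    define \<epsilon>' where "\<epsilon>' i = (if i \<in> insert p A' then \<epsilon> i else z' i)" for i
    have "(\<Sum>i\<in>insert p A. (\<epsilon>' i - z' i) *\<^sub>R v i) = (\<Sum>i\<in>insert p A'. (\<epsilon> i - z' i) *\<^sub>R v i)"
      using A'A fin by (intro sum.mono_neutral_cong_right) (auto simp: \<epsilon>'_def)
    moreover have "(\<Sum>i\<in>insert p A. (\<epsilon>' i - z i) *\<^sub>R v i)
        = (\<Sum>i\<in>insert p A. (\<epsilon>' i - z' i) *\<^sub>R v i + d *\<^sub>R U i *\<^sub>R v i)"
      by (intro sum.cong) (auto simp: z'_def algebra_simps)
    ultimately have "(\<Sum>i\<in>insert p A. (\<epsilon>' i - z i) *\<^sub>R v i)
        = (\<Sum>i\<in>insert p A'. (\<epsilon> i - z' i) *\<^sub>R v i) + d *\<^sub>R b"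
      by (simp only: bU sum.distrib scaleR_sum_right)
    then have "(\<Sum>j\<in>J. c j * exp (ip (\<theta> j) (\<Sum>i\<in>insert p A. (\<epsilon>' i - z i) *\<^sub>R v i)))
        = (\<Sum>j\<in>J. c' j * exp (ip (\<theta> j) (\<Sum>i\<in>insert p A'. (\<epsilon> i - z' i) *\<^sub>R v i)))"
      by (simp only:) (simp add: c'_def a_def ip_add_right[of _ _ "d *\<^sub>R b"] ip_scaleR_right[of _ d b] exp_add mult_ac)
    also note \<epsilon>(2)
    also have "(\<Sum>j\<in>J. c' j * exp (ip (\<eta>' j) (\<eta>' j) / 2 + pot (z' p) (ip (\<theta> j) b') (ip b' b'))) \<le> F d"
      unfolding F_def using le c0
      by (intro sum_mono) (auto simp: c'_def intro!: mult_left_mono)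
    also note d(1)
    finally show ?thesis
      using \<epsilon>(1) z'A by (intro exI[of _ \<epsilon>']) (auto simp: F_def a_def r_def \<epsilon>'_def)
  qed
qed

text \<open>The walk starts at \<open>0\<close> with the zero vector as an already frozen pivot \<open>None\<close>.\<close>

lemma gram_schmidt_walk_signs:
  fixes v :: "'i \<Rightarrow> 'a" and \<theta> :: "'j \<Rightarrow> 'a"
  assumes "finite A" "\<And>i. i \<in> A \<Longrightarrow> ip (v i) (v i) \<le> 1"
    and "\<And>j. j \<in> J \<Longrightarrow> c j \<ge> 0"
  obtains \<epsilon> where "\<And>i. i \<in> A \<Longrightarrow> \<epsilon> i \<in> {-1, 1}"
    "(\<Sum>j\<in>J. c j * exp (ip (\<theta> j) (\<Sum>i\<in>A. \<epsilon> i *\<^sub>R v i)))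
      \<le> (\<Sum>j\<in>J. c j * exp (ip (\<theta> j) (\<theta> j) / 2))"
proof -
  define A' where "A' = Some ` A"
  define v' where "v' = case_option 0 v"
  define z :: "'i option \<Rightarrow> real" where "z = case_option 1 (\<lambda>_. 0)"
  have "\<exists>\<epsilon>. (\<forall>i\<in>insert None A'. \<epsilon> i \<in> {-1, 1}) \<and>
    (\<Sum>j\<in>J. c j * exp (ip (\<theta> j) (\<Sum>i\<in>insert None A'. (\<epsilon> i - z i) *\<^sub>R v' i)))
    \<le> (\<Sum>j\<in>J. c j * exp (ip (\<theta> j) (\<theta> j) / 2 + pot (z None) (ip (\<theta> j) 0) (ip 0 0)))"
    using assms
    by (intro gram_schmidt_walk_phase[where u = "\<lambda>_. 0"]) (auto simp: A'_def v'_def z_def)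
  then obtain \<epsilon> where \<epsilon>: "\<forall>i\<in>insert None A'. \<epsilon> i \<in> {-1, 1}"
    "(\<Sum>j\<in>J. c j * exp (ip (\<theta> j) (\<Sum>i\<in>insert None A'. (\<epsilon> i - z i) *\<^sub>R v' i)))
    \<le> (\<Sum>j\<in>J. c j * exp (ip (\<theta> j) (\<theta> j) / 2 + pot (z None) (ip (\<theta> j) 0) (ip 0 0)))" by blast
  have "(\<Sum>i\<in>insert None A'. (\<epsilon> i - z i) *\<^sub>R v' i) = (\<Sum>i\<in>A. \<epsilon> (Some i) *\<^sub>R v i)"
    using assms(1) by (subst sum.insert) (auto simp: A'_def v'_def z_def sum.reindex)
  then show ?thesis
    using that[of "\<lambda>i. \<epsilon> (Some i)"] \<epsilon> by (simp add: pot_def z_def tilt_def A'_def)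
qed

section \<open>Orthonormal expansions up to null vectors\<close>

text \<open>Gram--Schmidt, adding nothing when the residual is null. Expansions hold only modulo
  null vectors, hence the formulation through the form.\<close>

lemma orthonormal_family_exists:
  assumes "finite B"
  shows "\<exists>U. finite U \<and> card U \<le> card B \<and>
    (\<forall>x\<in>U. \<forall>y\<in>U. ip x y = (if x = y then 1 else 0)) \<and>
    (\<forall>x\<in>B. \<forall>y. ip y (x - (\<Sum>u\<in>U. ip x u *\<^sub>R u)) = 0)"
  using assms
proof (induction B rule: finite_induct)
  case (insert k B)
  then obtain U where U: "finite U" "card U \<le> card B"
      "\<And>x y. x \<in> U \<Longrightarrow> y \<in> U \<Longrightarrow> ip x y = (if x = y then 1 else 0)"
      "\<And>x y. x \<in> B \<Longrightarrow> ip y (x - (\<Sum>u\<in>U. ip x u *\<^sub>R u)) = 0"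
    by blast
  define r where "r = k - (\<Sum>u\<in>U. ip k u *\<^sub>R u)"
  show ?case
  proof (cases "ip r r = 0")
    case True
    then have "ip y r = 0" for y by (rule ip_null)
    then show ?thesis using U insert.hyps by (intro exI[of _ U]) (auto simp: r_def)
  next
    case False
    then have rpos: "ip r r > 0" using ip_nonneg[of r] by simp
    define e where "e = (1 / sqrt (ip r r)) *\<^sub>R r"
    have ee: "ip e e = 1" using rpos by (simp add: e_def ip_scaleR_left ip_scaleR_right)
    have ru: "ip r u = 0" if "u \<in> U" for u
    proof -
      have "(\<Sum>w\<in>U. ip k w * ip w u) = (\<Sum>w\<in>U. if w = u then ip k w else 0)"
        using U(3) that by (intro sum.cong) auto
      then show ?thesis
        using U(1) that by (simp add: r_def ip_diff_left ip_sum_left ip_scaleR_left)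
    qed
    have ur: "ip u r = 0" if "u \<in> U" for u using ru[OF that] ip_commute by simp
    have eu: "ip e u = 0" "ip u e = 0" if "u \<in> U" for u
      using ru[OF that] ur[OF that] by (simp_all add: e_def ip_scaleR_left ip_scaleR_right)
    have eU: "e \<notin> U" using eu ee by fastforce
    have "ip k r = ip (r + (\<Sum>u\<in>U. ip k u *\<^sub>R u)) r" by (simp add: r_def)
    also have "\<dots> = ip r r"
      using ur by (simp add: ip_add_left ip_sum_left ip_scaleR_left)
    finally have "ip k e *\<^sub>R e = r"
      using rpos by (simp add: e_def ip_scaleR_right)
    then have k: "k - (\<Sum>u\<in>insert e U. ip k u *\<^sub>R u) = 0"
      using U(1) eU by (simp add: r_def)
    \<comment> \<open>\<open>e\<close> is orthogonal to \<open>U\<close> and to the residual of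
      \<open>x\<close>, hence to \<open>x\<close>, so the new term of the expansion
      vanishes.\<close>
    have old: "ip y (x - (\<Sum>u\<in>insert e U. ip x u *\<^sub>R u)) = 0" if x: "x \<in> B" for x y
    proof -
      have "ip e (x - (\<Sum>u\<in>U. ip x u *\<^sub>R u)) = 0" by (rule U(4)[OF x])
      then have "ip x e = 0"
        using eu ip_commute[of e x] by (simp add: ip_diff_right ip_sum_right ip_scaleR_right)
      then show ?thesis using U(1) eU U(4)[OF x] by simp
    qed
    show ?thesis
      using U(1-3) eU eu ee k old insert.hyps by (intro exI[of _ "insert e U"]) auto
  qed
qed auto

lemma orthonormal_family_span:
  assumes "\<forall>x\<in>B. \<forall>y. ip y (x - (\<Sum>u\<in>U. ip x u *\<^sub>R u)) = 0" "x \<in> span B"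
  shows "ip y (x - (\<Sum>u\<in>U. ip x u *\<^sub>R u)) = 0"
  using assms(2)
proof (induction rule: span_induct_alt)
  case base
  then show ?case by simp
next
  case (step c x w)
  have "c *\<^sub>R x + w - (\<Sum>u\<in>U. ip (c *\<^sub>R x + w) u *\<^sub>R u)
      = c *\<^sub>R (x - (\<Sum>u\<in>U. ip x u *\<^sub>R u)) + (w - (\<Sum>u\<in>U. ip w u *\<^sub>R u))"
    by (simp add: ip_add_left ip_scaleR_left scaleR_add_left sum.distrib scaleR_sum_right algebra_simps)
  then show ?case using step assms(1) by (simp only: ip_add_right ip_scaleR_right mult_zero_right add_0)
qed

end

section \<open>Signs for bounded sequences\<close>

definition ip_on :: "nat set \<Rightarrow> linf \<Rightarrow> linf \<Rightarrow> real" where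
  "ip_on J x y = (\<Sum>j\<in>J. x j * y j)"

lemma semi_inner_ip_on: "semi_inner (ip_on J)"
  by unfold_locales
    (auto simp: ip_on_def algebra_simps sum.distrib sum_distrib_left intro: sum_nonneg)

lemma apply_bcontfun_sum: "apply_bcontfun (\<Sum>i\<in>A. f i) j = (\<Sum>i\<in>A. apply_bcontfun (f i) j)"
  for f :: "'i \<Rightarrow> 'a::topological_space \<Rightarrow>\<^sub>C 'b::real_normed_vector"
  by (induction A rule: infinite_finite_induct) auto

text \<open>From \<open>ln (1 / p) \<le> 1 / p - 1\<close>. The factor \<open>p\<close> pulled out
  lets the union bound use the sum of the squared lengths.\<close>

lemma exp_neg_divide_le:
  fixes p s :: real
  assumes "0 < p" "p \<le> 1" "1 \<le> s"
  shows "exp (- s / p) \<le> p * exp (- s)"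
proof -
  have "- ln p \<le> 1 / p - 1"
    using ln_le_minus_one[of "1 / p"] assms by (simp add: ln_div)
  also have "\<dots> \<le> s * (1 / p - 1)"
    using assms by (simp add: mult_le_cancel_right1)
  finally have "- s / p \<le> ln p + - s" by (simp add: algebra_simps)
  then have "exp (- s / p) \<le> exp (ln p + - s)" by (simp only: exp_le_cancel_iff)
  also have "\<dots> = p * exp (- s)" using assms by (simp only: exp_add exp_ln)
  finally show ?thesis .
qed

text \<open>Restricting the functionals \<open>x \<mapsto> x j\<close> to the span of \<open>B\<close>, they are represented by vectors
  \<open>e j\<close> whose squared lengths \<open>p j\<close> sum to at most \<open>card B\<close>. Weighting the exponential moment of
  coordinate \<open>j\<close> with parameter \<open>t / p j\<close> makes the union bound depend only on that sum.\<close>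

lemma signs_on_finite_coordinates:
  fixes x :: "'i \<Rightarrow> linf"
  assumes "finite A" "finite J" "finite B" "\<And>i. i \<in> A \<Longrightarrow> x i \<in> span B"
    and x1: "\<And>i. i \<in> A \<Longrightarrow> (\<Sum>j\<in>J. (x i j)\<^sup>2) \<le> 1"
    and n: "real (card B) \<le> n" "2 \<le> n"
  obtains \<epsilon> where "\<And>i. i \<in> A \<Longrightarrow> \<epsilon> i \<in> {-1, 1::real}"
    "\<And>j. j \<in> J \<Longrightarrow> \<bar>\<Sum>i\<in>A. \<epsilon> i * x i j\<bar> \<le> 3 * sqrt (ln n)"
proof -
  interpret semi_inner "ip_on J" by (rule semi_inner_ip_on)
  obtain U where U: "finite U" "card U \<le> card B"
      "\<forall>x\<in>U. \<forall>y\<in>U. ip_on J x y = (if x = y then 1 else 0)"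
      "\<forall>x\<in>B. \<forall>y. ip_on J y (x - (\<Sum>u\<in>U. ip_on J x u *\<^sub>R u)) = 0"
    using orthonormal_family_exists[OF \<open>finite B\<close>] by blast
  \<comment> \<open>The constant 3 makes the union bound at most
    \<open>2 * n * exp (- t^2 / 2) \<le> n^2 * n^(-9/2) < 1\<close>.\<close>
  define t where "t = 3 * sqrt (ln n)"
  define e :: "nat \<Rightarrow> linf" where "e j = (\<Sum>u\<in>U. apply_bcontfun u j *\<^sub>R u)" for j
  define p where "p j = (\<Sum>u\<in>U. (apply_bcontfun u j)\<^sup>2)" for j
  have eval: "y j = ip_on J y (e j)" if "y \<in> span B" "j \<in> J" for y j
  proof -
    define w where "w = y - (\<Sum>u\<in>U. ip_on J y u *\<^sub>R u)"
    \<comment> \<open>A residual of zero length vanishes at every coordinate in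
      \<open>J\<close>.\<close>
    have "ip_on J w w = 0" using orthonormal_family_span[OF U(4) that(1)] by (simp add: w_def)
    then have "w j = 0" using that(2) \<open>finite J\<close> by (simp add: ip_on_def sum_nonneg_eq_0_iff)
    then show ?thesis
      by (simp add: w_def e_def apply_bcontfun_sum ip_sum_right ip_scaleR_right mult.commute)
  qed
  have ee: "ip_on J (e j) (e j) = p j" for j
  proof -
    have "ip_on J u (e j) = u j" if "u \<in> U" for u
    proof -
      have "ip_on J u (e j) = (\<Sum>w\<in>U. apply_bcontfun w j * ip_on J u w)"
        by (simp add: e_def ip_sum_right ip_scaleR_right)
      also have "\<dots> = (\<Sum>w\<in>U. if w = u then apply_bcontfun w j else 0)"
        using U(3) that by (intro sum.cong) auto
      finally show ?thesis using U(1) that by simp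
    qed
    moreover have "ip_on J (e j) (e j) = (\<Sum>u\<in>U. apply_bcontfun u j * ip_on J u (e j))"
      by (subst e_def) (simp add: ip_sum_left ip_scaleR_left)
    ultimately show ?thesis by (simp add: p_def power2_eq_square)
  qed
  have p0: "p j \<ge> 0" for j by (simp add: p_def sum_nonneg)
  \<comment> \<open>\<open>p j\<close> is both the value of \<open>e j\<close> at \<open>j\<close>
    and its squared length, so its square is one term of that length.\<close>
  have p1: "p j \<le> 1" if "j \<in> J" for j
  proof -
    have "e j j = p j" by (simp add: e_def p_def apply_bcontfun_sum power2_eq_square)
    then have "p j * p j \<le> ip_on J (e j) (e j)"
      using member_le_sum[of j J "\<lambda>i. e j i * e j i"] \<open>finite J\<close> that by (simp add: ip_on_def)
    then have "p j * p j \<le> p j * 1" by (simp add: ee)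
    then show ?thesis using p0[of j] by (cases "p j = 0") auto
  qed
  have "(\<Sum>j\<in>J. p j) = (\<Sum>u\<in>U. ip_on J u u)"
    unfolding p_def ip_on_def by (subst sum.swap) (simp add: power2_eq_square)
  also have "\<dots> = real (card U)" using U(3) by simp
  finally have sump: "(\<Sum>j\<in>J. p j) \<le> n" using U(2) n by simp
  \<comment> \<open>Where \<open>p j = 0\<close>, every vector of the span vanishes at
    \<open>j\<close>; leaving these out avoids division by 0.\<close>
  define J' where "J' = {j\<in>J. p j > 0}"
  define S where "S = J' \<times> {-1, 1::real}"
  define c where "c = (\<lambda>(j, s::real). exp (- (t\<^sup>2 / p j)))"
  define \<theta> where "\<theta> = (\<lambda>(j, s::real). (s * t / p j) *\<^sub>R e j)"
  have finJ': "finite J'" using \<open>finite J\<close> by (simp add: J'_def)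
  have finS: "finite S" using finJ' by (simp add: S_def)
  have ln2: "ln n \<ge> ln 2" using n by simp
  have t2: "t\<^sup>2 = 9 * ln n" using n by (simp add: t_def power_mult_distrib)
  have ln2': "ln (2::real) \<ge> 1/2" using ln_2_less_1 ln_le_minus_one[of "1/2::real"] by (simp add: ln_div)
  have x1': "ip_on J (x i) (x i) \<le> 1" if "i \<in> A" for i
    using x1[OF that] by (simp add: ip_on_def power2_eq_square)
  have c0: "c k \<ge> 0" for k by (simp add: c_def split: prod.split)
  obtain \<epsilon> where \<epsilon>: "\<And>i. i \<in> A \<Longrightarrow> \<epsilon> i \<in> {-1, 1}"
    "(\<Sum>k\<in>S. c k * exp (ip_on J (\<theta> k) (\<Sum>i\<in>A. \<epsilon> i *\<^sub>R x i)))
      \<le> (\<Sum>k\<in>S. c k * exp (ip_on J (\<theta> k) (\<theta> k) / 2))"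
    by (rule gram_schmidt_walk_signs[where A = A and v = x and J = S and c = c and \<theta> = \<theta>])
      (use \<open>finite A\<close> x1' c0 that in auto)
  define X where "X = (\<Sum>i\<in>A. \<epsilon> i *\<^sub>R x i)"
  have Xspan: "X \<in> span B" unfolding X_def by (intro span_sum span_scale assms(4))
  have "(\<Sum>k\<in>S. c k * exp (ip_on J (\<theta> k) (\<theta> k) / 2)) = (\<Sum>j\<in>J'. 2 * exp (- (t\<^sup>2 / 2) / p j))"
  proof -
    have "c (j, s) * exp (ip_on J (\<theta> (j, s)) (\<theta> (j, s)) / 2) = exp (- (t\<^sup>2 / 2) / p j)"
      if "j \<in> J'" "s \<in> {-1, 1}" for j s
    proof -
      have "p j > 0" using that by (simp add: J'_def)
      then have "ip_on J (\<theta> (j, s)) (\<theta> (j, s)) / 2 = t\<^sup>2 / (2 * p j)"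
        using that(2) by (auto simp: \<theta>_def ip_scaleR_left ip_scaleR_right ee power2_eq_square)
      then show ?thesis by (simp add: c_def flip: exp_add)
    qed
    then show ?thesis
      unfolding S_def sum.cartesian_product' by simp
  qed
  also have "\<dots> \<le> (\<Sum>j\<in>J'. 2 * (p j * exp (- (t\<^sup>2 / 2))))"
    using p1 t2 ln2 ln2' by (intro sum_mono mult_left_mono exp_neg_divide_le) (auto simp: J'_def)
  also have "\<dots> = 2 * exp (- (t\<^sup>2 / 2)) * (\<Sum>j\<in>J'. p j)"
    unfolding sum_distrib_left by (intro sum.cong) auto
  also have "\<dots> \<le> 2 * exp (- (t\<^sup>2 / 2)) * n"
  proof -
    have "(\<Sum>j\<in>J'. p j) \<le> (\<Sum>j\<in>J. p j)"
      using \<open>finite J\<close> p0 by (intro sum_mono2) (auto simp: J'_def)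
    then show ?thesis using sump by (intro mult_left_mono) auto
  qed
  also have "\<dots> \<le> n * n * exp (- (t\<^sup>2 / 2))" using n by simp
  also have "\<dots> = exp (ln n) * exp (ln n) * exp (- (t\<^sup>2 / 2))" using n by simp
  also have "\<dots> = exp (ln n + ln n + - (t\<^sup>2 / 2))" by (simp only: exp_add)
  also have "\<dots> < 1" using t2 ln2 ln2' by simp
  finally have less1: "(\<Sum>k\<in>S. c k * exp (ip_on J (\<theta> k) X)) < 1"
    using \<epsilon>(2) by (simp add: X_def)
  \<comment> \<open>Markov's argument: a coordinate exceeding \<open>t\<close> would alone
    contribute at least 1, through the pair \<open>(j, s)\<close> with \<open>s\<close> its
    sign.\<close>
  have "\<bar>X j\<bar> \<le> t" if j: "j \<in> J" for j
  proof (rule ccontr)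
    assume big: "\<not> ?thesis"
    have t0: "t \<ge> 0" using n by (simp add: t_def)
    have Xj: "X j = ip_on J (e j) X" using eval[OF Xspan j] ip_commute by simp
    have "p j \<noteq> 0"
      using big t0 eval[OF Xspan j] ip_null[of "e j" X] ee[of j] by auto
    then have pj: "p j > 0" using p0[of j] by simp
    define s where "s = sgn (X j)"
    have s: "s \<in> {-1, 1}" "s * X j = \<bar>X j\<bar>" using big t0 by (auto simp: s_def sgn_if)
    have k: "(j, s) \<in> S" using j pj s(1) by (auto simp: S_def J'_def)
    have "ip_on J (\<theta> (j, s)) X = t / p j * (s * X j)"
      by (simp add: \<theta>_def ip_scaleR_left Xj)
    also have "\<dots> \<ge> t / p j * t"
      unfolding s(2) using big t0 pj by (intro mult_left_mono) auto
    finally have "1 \<le> c (j, s) * exp (ip_on J (\<theta> (j, s)) X)"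
      by (simp add: c_def power2_eq_square flip: exp_add)
    also have "\<dots> \<le> (\<Sum>k\<in>S. c k * exp (ip_on J (\<theta> k) X))"
      using finS k by (intro member_le_sum) (auto simp: c_def)
    finally show False using less1 by simp
  qed
  then show ?thesis using that[of \<epsilon>] \<epsilon>(1) by (simp add: X_def apply_bcontfun_sum t_def)
qed

text \<open>There are only finitely many sign patterns, so if each failed at some coordinate, then
  all would fail on a common finite set of coordinates.\<close>

lemma signs_norm_le:
  fixes x :: "'i \<Rightarrow> linf"
  assumes "finite A" "finite B" "\<And>i. i \<in> A \<Longrightarrow> x i \<in> span B"
    and x1: "\<And>i J. i \<in> A \<Longrightarrow> finite J \<Longrightarrow> (\<Sum>j\<in>J. (x i j)\<^sup>2) \<le> 1"
    and n: "real (card B) \<le> n" "2 \<le> n"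
  obtains \<epsilon> where "\<And>i. i \<in> A \<Longrightarrow> \<epsilon> i \<in> {-1, 1::real}"
    "norm (\<Sum>i\<in>A. \<epsilon> i *\<^sub>R x i) \<le> 3 * sqrt (ln n)"
proof -
  define E where "E = A \<rightarrow>\<^sub>E {-1, 1::real}"
  have "\<exists>\<epsilon>\<in>E. \<forall>j. \<bar>\<Sum>i\<in>A. \<epsilon> i * x i j\<bar> \<le> 3 * sqrt (ln n)"
  proof (rule ccontr)
    assume "\<not> ?thesis"
    then obtain f where f: "\<And>\<epsilon>. \<epsilon> \<in> E \<Longrightarrow> \<not> \<bar>\<Sum>i\<in>A. \<epsilon> i * x i (f \<epsilon>)\<bar> \<le> 3 * sqrt (ln n)"
      by metis
    have finE: "finite E" using \<open>finite A\<close> by (auto simp: E_def intro: finite_PiE)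
    obtain \<epsilon> where \<epsilon>: "\<And>i. i \<in> A \<Longrightarrow> \<epsilon> i \<in> {-1, 1::real}"
      "\<And>j. j \<in> f ` E \<Longrightarrow> \<bar>\<Sum>i\<in>A. \<epsilon> i * x i j\<bar> \<le> 3 * sqrt (ln n)"
      by (rule signs_on_finite_coordinates[of A "f ` E" B x n]) (use assms finE that in auto)
    define \<epsilon>' where "\<epsilon>' = restrict \<epsilon> A"
    have "\<epsilon>' \<in> E" using \<epsilon>(1) by (auto simp: \<epsilon>'_def E_def)
    moreover have "(\<Sum>i\<in>A. \<epsilon>' i * x i j) = (\<Sum>i\<in>A. \<epsilon> i * x i j)" for j
      by (intro sum.cong) (auto simp: \<epsilon>'_def)
    ultimately show False using f[of \<epsilon>'] \<epsilon>(2) by auto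
  qed
  then obtain \<epsilon> where "\<epsilon> \<in> E" "\<And>j. \<bar>\<Sum>i\<in>A. \<epsilon> i * x i j\<bar> \<le> 3 * sqrt (ln n)" by blast
  then show ?thesis
    by (intro that[of \<epsilon>] norm_bound) (auto simp: E_def apply_bcontfun_sum)
qed

section \<open>The l2 norm and the final bound\<close>

lemma sum_squares_le_l2norm:
  assumes "l2norm x \<le> ennreal \<mu>" "\<mu> \<ge> 0" "finite J"
  shows "(\<Sum>j\<in>J. (x j)\<^sup>2) \<le> \<mu>\<^sup>2"
proof -
  have s: "summable (\<lambda>j. \<bar>x j\<bar>\<^sup>2)"
    using assms(1) by (auto simp: l2norm_def top_unique split: if_splits)
  then have "sqrt (\<Sum>j. \<bar>x j\<bar>\<^sup>2) \<le> \<mu>"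
    using assms(1,2) by (simp add: l2norm_def)
  then have "(\<Sum>j. \<bar>x j\<bar>\<^sup>2) \<le> \<mu>\<^sup>2"
    by (rule sqrt_le_D)
  moreover have "(\<Sum>j\<in>J. \<bar>x j\<bar>\<^sup>2) \<le> (\<Sum>j. \<bar>x j\<bar>\<^sup>2)"
    using s assms(3) by (intro sum_le_suminf) auto
  ultimately show ?thesis by simp
qed

theorem proposition1:
  "\<exists>C::real. C > 0 \<and>
    (\<forall>(m::nat) (x :: nat \<Rightarrow> linf). m > 0 \<longrightarrow>
      (\<exists>\<epsilon> :: nat \<Rightarrow> real. (\<forall>i\<in>{1..m}. \<epsilon> i \<in> {-1, 1}) \<and>
        (let d = dim (span (x ` {1..m}));
             M = (MAX i\<in>{1..m}. l2norm (apply_bcontfun (x i)))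
         in ennreal (norm (\<Sum>i=1..m. \<epsilon> i *\<^sub>R x i)) \<le> ennreal (C * sqrt (nlog d)) * M \<and>
            ennreal (C * sqrt (nlog d)) * M \<le> ennreal (C * sqrt (nlog m)) * M)))"
proof (rule exI[of _ 3], intro conjI allI impI)
  fix m :: nat and x :: "nat \<Rightarrow> linf"
  define d where "d = dim (span (x ` {1..m}))"
  define M where "M = (MAX i\<in>{1..m}. l2norm (apply_bcontfun (x i)))"
  assume m: "m > 0"
  have "d \<le> card (x ` {1..m})" unfolding d_def dim_span by (rule dim_le_card') simp
  then have "d \<le> m" using card_image_le[of "{1..m}" x] by simp
  then have dm: "ennreal (3 * sqrt (nlog d)) * M \<le> ennreal (3 * sqrt (nlog m)) * M"
    by (intro mult_right_mono ennreal_leI) (auto simp: nlog_def)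
  have le_M: "l2norm (apply_bcontfun (x i)) \<le> M" if "i \<in> {1..m}" for i
    unfolding M_def using that by (intro Max_ge) auto
  have nlog_pos: "nlog d > 0" by (simp add: nlog_def)
  have "\<exists>\<epsilon> :: nat \<Rightarrow> real. (\<forall>i\<in>{1..m}. \<epsilon> i \<in> {-1, 1}) \<and>
    ennreal (norm (\<Sum>i=1..m. \<epsilon> i *\<^sub>R x i)) \<le> ennreal (3 * sqrt (nlog d)) * M"
  proof (cases M rule: ennreal_cases)
    \<comment> \<open>The right-hand side is infinite, since its other factor is positive.\<close>
    case top
    then show ?thesis
      using nlog_pos by (intro exI[of _ "\<lambda>_. 1"]) (simp add: ennreal_mult_top)
  next
    case (real \<mu>)
    have sq: "(\<Sum>j\<in>J. (x i j)\<^sup>2) \<le> \<mu>\<^sup>2" if "i \<in> {1..m}" "finite J" for i J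
      using sum_squares_le_l2norm le_M[OF that(1)] real that(2) by auto
    show ?thesis
    proof (cases "\<mu> = 0")
      \<comment> \<open>Normalisation by \<open>\<mu>\<close> is impossible, but all vectors are
        0.\<close>
      case True
      have "x i = 0" if "i \<in> {1..m}" for i
        using sq[OF that, of "{_}"] True by (intro bcontfun_eqI) simp
      then show ?thesis by (intro exI[of _ "\<lambda>_. 1"]) simp
    next
      case False
      then have \<mu>: "\<mu> > 0" using real by simp
      \<comment> \<open>The dimension enters the bound as the size of this basis.\<close>
      obtain B where B: "B \<subseteq> x ` {1..m}" "independent B" "x ` {1..m} \<subseteq> span B" "card B = d"
        using basis_exists[of "x ` {1..m}"] by (auto simp: d_def)
      have finB: "finite B" using B(1) by (rule finite_subset) simp
      obtain \<epsilon> where \<epsilon>: "\<And>i. i \<in> {1..m} \<Longrightarrow> \<epsilon> i \<in> {-1, 1::real}"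
        "norm (\<Sum>i=1..m. \<epsilon> i *\<^sub>R (1 / \<mu>) *\<^sub>R x i) \<le> 3 * sqrt (ln (max 2 (real d)))"
      proof (rule signs_norm_le[of "{1..m}" B "\<lambda>i. (1 / \<mu>) *\<^sub>R x i" "max 2 (real d)"])
        show "(1 / \<mu>) *\<^sub>R x i \<in> span B" if "i \<in> {1..m}" for i
          using B(3) that by (intro span_scale) auto
        show "(\<Sum>j\<in>J. (apply_bcontfun ((1 / \<mu>) *\<^sub>R x i) j)\<^sup>2) \<le> 1"
          if "i \<in> {1..m}" "finite J" for i J
          using sq[OF that] \<mu> by (simp add: power_divide divide_le_eq flip: sum_divide_distrib)
      qed (use finB B(4) in auto)
      have "(\<Sum>i=1..m. \<epsilon> i *\<^sub>R x i) = \<mu> *\<^sub>R (\<Sum>i=1..m. \<epsilon> i *\<^sub>R (1 / \<mu>) *\<^sub>R x i)"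
        using \<mu> by (simp add: scaleR_sum_right)
      then have "norm (\<Sum>i=1..m. \<epsilon> i *\<^sub>R x i) \<le> \<mu> * (3 * sqrt (nlog d))"
        using \<epsilon>(2) \<mu> by (simp add: nlog_def)
      then have "ennreal (norm (\<Sum>i=1..m. \<epsilon> i *\<^sub>R x i)) \<le> ennreal (3 * sqrt (nlog d) * \<mu>)"
        by (intro ennreal_leI) (simp add: mult_ac)
      then show ?thesis
        using \<epsilon>(1) real nlog_pos by (intro exI[of _ \<epsilon>]) (auto simp: ennreal_mult)
    qed
  qed
  then show "\<exists>\<epsilon> :: nat \<Rightarrow> real. (\<forall>i\<in>{1..m}. \<epsilon> i \<in> {-1, 1}) \<and>
        (let d = dim (span (x ` {1..m}));
             M = (MAX i\<in>{1..m}. l2norm (apply_bcontfun (x i)))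
         in ennreal (norm (\<Sum>i=1..m. \<epsilon> i *\<^sub>R x i)) \<le> ennreal (3 * sqrt (nlog d)) * M \<and>
            ennreal (3 * sqrt (nlog d)) * M \<le> ennreal (3 * sqrt (nlog m)) * M)"
    using dm unfolding Let_def d_def M_def by blast
qed simp

end
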